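(* Let $(X,g)$ be an even-dimensional compact oriented Riemannian manifold of dimension $n$ with boundary $Y$ and product metric near the boundary. Let $\eta\in C^\infty(X)$ be such that the function $\eta\cup\eta$ on the double $\widetilde X=X\cup_YX$ (equal to $\eta$ on both copies of $X$) is smooth, and let $\widetilde g=e^{\eta}g$. Then for all $f_1,f_2\in C^\infty(X)$ $$\Omega_{n,g}(f_1,f_2)=\Omega_{n,\widetilde g}(f_1,f_2),$$ i.e. $\Omega_n(f_1,f_2)$ is subconformally invariant.
   Context: $C^\infty(X)=\{f|_X: f\in C^\infty(\widetilde X)\}$. A subconformal manifold is an equivalence class of Riemannian manifolds, where two metrics $g,\widetilde g$ on $X$ are equivalent if $\widetilde g=e^{\eta}g$ with $\eta\in C^\infty(X)$ and $\eta\cup\eta\in C^\infty(\widetilde X)$. For a metric $h$ on $X$ whose double $h\cup h$ (equal to $h$ on both copies of $X$) is a smooth metric on $\widetilde X$ (this is the case for $g$ and $\widetilde g$), let $F$ be the operator on $L^2(\widetilde X,\wedge_c^{n/2}T^*\widetilde X)$ given by $F=2P-1$, with $P$ the orthogonal projection onto the image of $d$ with respect to $h\cup h$ (equivalently $F=(d\delta-\delta d)/(d\delta+\delta d)$ off the harmonic forms). Then $$\Omega_{n,h}(f_1,f_2)=\mathrm{wres}([F,\bar f_1][F,\bar f_2])|_X,\qquad \mathrm{wres}(A)=\int_{|\xi|=1}\mathrm{tr}\,a_{-n}(x,\xi)\,\sigma(\xi)\,dx,$$ where $\bar f_i\in C^\infty(\widetilde X)$ are arbitrary extensions of $f_i$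 (the result does not depend on them), $a_{-n}$ is the component of order $-n$ of the symbol of $A$, and $\sigma(\xi)$ is the canonical volume form on the unit sphere. *)

theory Defs
  imports "HOL-Analysis.Analysis"
begin

section \<open>Smooth maps\<close>

(* iter_deriv [v1, ..., vm] f is the iterated directional derivative
   D_{v1} (... (D_{vm} f)). *)
fun iter_deriv :: "'a::real_normed_vector list \<Rightarrow> ('a \<Rightarrow> 'b::real_normed_vector) \<Rightarrow> 'a \<Rightarrow> 'b" where
  "iter_deriv [] f = f"
| "iter_deriv (v # vs) f = (\<lambda>x. frechet_derivative (iter_deriv vs f) (at x) v)"

(* Smoothness on an arbitrary set: near every point there is a smooth extension to an open
   neighbourhood.  For open S this is ordinary C-infinity smoothness; for relatively open subsets
   of a half-space it is the usual notion of smoothness up to the boundary. *)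
definition smooth_on :: "'a::real_normed_vector set \<Rightarrow> ('a \<Rightarrow> 'b::real_normed_vector) \<Rightarrow> bool" where
  "smooth_on S f \<longleftrightarrow> (\<forall>x\<in>S. \<exists>W F. open W \<and> x \<in> W \<and> (\<forall>y\<in>W \<inter> S. F y = f y) \<and>
     (\<forall>vs. \<forall>y\<in>W. iter_deriv vs F differentiable (at y)))"


section \<open>Charts and manifolds with boundary\<close>

(* R^n and the n x n matrices, i.e. real ^ 'n and real ^ 'n ^ 'n without the sort constraint that
   the latter notation inserts. *)
type_synonym 'n rvec = "(real, 'n) vec"
type_synonym 'n rmat = "((real, 'n) vec, 'n) vec"

(* A chart is a pair of its domain and its coordinate map; values of the map outside the domain
   carry no information. *)
type_synonym ('p, 'n) chart = "'p set \<times> ('p \<Rightarrow> 'n rvec)"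

definition img :: "('p, 'n) chart \<Rightarrow> ('n rvec) set" where
  "img C = snd C ` fst C"

definition cinv :: "('p, 'n) chart \<Rightarrow> 'n rvec \<Rightarrow> 'p" where
  "cinv C = inv_into (fst C) (snd C)"

definition transition :: "('p, 'n) chart \<Rightarrow> ('p, 'n) chart \<Rightarrow> 'n rvec \<Rightarrow> 'n rvec" where
  "transition C D = (\<lambda>y. snd D (cinv C y))"

definition overlap :: "('p, 'n) chart \<Rightarrow> ('p, 'n) chart \<Rightarrow> ('n rvec) set" where
  "overlap C D = snd C ` (fst C \<inter> fst D)"

(* The derivative is taken within the overlap, so that it also makes sense at boundary points. *)
definition jac :: "('p, 'n::finite) chart \<Rightarrow> ('p, 'n) chart \<Rightarrow> 'n rvec \<Rightarrow> 'n rmat" where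
  "jac C D y = jacobian (transition C D) (at y within overlap C D)"

definition points :: "('p, 'n) chart set \<Rightarrow> 'p set" where
  "points A = (\<Union>C\<in>A. fst C)"

(* Index of the coordinate x_n; the model half-space is x_n >= 0. *)
definition nrm :: "'n::{finite, linorder}" where
  "nrm = Max UNIV"

definition halfspace :: "('n::{finite, linorder} rvec) set" where
  "halfspace = {y. 0 \<le> y $ nrm}"

definition is_chart :: "'a topology \<Rightarrow> ('a, 'n::{finite, linorder}) chart \<Rightarrow> bool" where
  "is_chart T C \<longleftrightarrow> openin T (fst C) \<and> openin (top_of_set halfspace) (img C) \<and>
     homeomorphic_map (subtopology T (fst C)) (top_of_set (img C)) (snd C)"

definition compat :: "('p, 'n::finite) chart \<Rightarrow> ('p, 'n) chart \<Rightarrow> bool" where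
  "compat C D \<longleftrightarrow> smooth_on (overlap C D) (transition C D) \<and> (\<forall>y\<in>overlap C D. 0 < det (jac C D y))"

(* A is a maximal oriented atlas of half-space charts. *)
definition oriented_structure :: "'a topology \<Rightarrow> ('a, 'n::{finite, linorder}) chart set \<Rightarrow> bool" where
  "oriented_structure T A \<longleftrightarrow> (\<forall>C\<in>A. is_chart T C) \<and> points A = topspace T \<and>
     (\<forall>C\<in>A. \<forall>D\<in>A. compat C D) \<and>
     (\<forall>C. is_chart T C \<and> (\<forall>D\<in>A. compat C D \<and> compat D C) \<longrightarrow> C \<in> A)"

definition compact_oriented_manifold ::
    "'a topology \<Rightarrow> ('a, 'n::{finite, linorder}) chart set \<Rightarrow> bool" where
  "compact_oriented_manifold T A \<longleftrightarrow> Hausdorff_space T \<and> second_countable T \<and> compact_space T \<and>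
     oriented_structure T A"

definition bdry :: "('a, 'n::{finite, linorder}) chart set \<Rightarrow> 'a set" where
  "bdry A = {x. \<exists>C\<in>A. x \<in> fst C \<and> snd C x $ nrm = 0}"

definition smooth_fun :: "('p, 'n::finite) chart set \<Rightarrow> ('p \<Rightarrow> 'b::real_normed_vector) \<Rightarrow> bool" where
  "smooth_fun A f \<longleftrightarrow> (\<forall>C\<in>A. smooth_on (img C) (\<lambda>y. f (cinv C y)))"

(* Tensor fields are families of local expressions indexed by the charts: the second argument
   ranges over the image of the chart. *)
type_synonym ('p, 'n) metric = "('p, 'n) chart \<Rightarrow> 'n rvec \<Rightarrow> 'n rmat"

definition riemannian_metric :: "('p, 'n::finite) chart set \<Rightarrow> ('p, 'n) metric \<Rightarrow> bool" where
  "riemannian_metric A g \<longleftrightarrow>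
     (\<forall>C\<in>A. smooth_on (img C) (g C) \<and>
        (\<forall>y\<in>img C. transpose (g C y) = g C y \<and> (\<forall>v. v \<noteq> 0 \<longrightarrow> 0 < v \<bullet> (g C y *v v)))) \<and>
     (\<forall>C\<in>A. \<forall>D\<in>A. \<forall>y\<in>overlap C D.
        g C y = transpose (jac C D y) ** g D (transition C D y) ** jac C D y)"

(* exp(eta) * g *)
definition conf :: "('p \<Rightarrow> real) \<Rightarrow> ('p, 'n::finite) metric \<Rightarrow> ('p, 'n) metric" where
  "conf \<eta> g = (\<lambda>C y. exp (\<eta> (cinv C y)) *\<^sub>R g C y)"


section \<open>Product metrics near the boundary and the double\<close>

(* For a map c on Y x [0,eps) and a chart phi of X: the chart c(y,t) |-> phi(y) + t e_n
   on the image of (dom phi \<inter> Y) x [0,eps). *)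
definition collar_chart ::
    "'a set \<Rightarrow> ('a \<Rightarrow> real \<Rightarrow> 'a) \<Rightarrow> real \<Rightarrow> ('a, 'n::{finite, linorder}) chart \<Rightarrow> ('a, 'n) chart" where
  "collar_chart Y c \<epsilon> C =
     ((\<lambda>(y, t). c y t) ` ((fst C \<inter> Y) \<times> {0..<\<epsilon>}),
      (\<lambda>x. case inv_into (Y \<times> {0..<\<epsilon>}) (\<lambda>(y, t). c y t) x of
             (y, t) \<Rightarrow> snd C y + t *\<^sub>R axis nrm 1))"

(* c is an (orientation compatible) diffeomorphism of Y x [0,eps) onto a neighbourhood of Y,
   being the identity on Y, and pulls g back to g_Y + dt^2: in the collar charts the matrix of g
   does not depend on t, and its last row (hence column) is (0,...,0,1). *)
definition product_collar ::
    "('a, 'n::{finite, linorder}) chart set \<Rightarrow> ('a, 'n) metric \<Rightarrow> ('a \<Rightarrow> real \<Rightarrow> 'a) \<Rightarrow> real \<Rightarrow> bool" where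
  "product_collar A g c \<epsilon> \<longleftrightarrow> 0 < \<epsilon> \<and> (\<forall>y\<in>bdry A. c y 0 = y) \<and>
     inj_on (\<lambda>(y, t). c y t) (bdry A \<times> {0..<\<epsilon>}) \<and>
     (\<forall>C\<in>A. let K = collar_chart (bdry A) c \<epsilon> C in K \<in> A \<and>
        (\<forall>y\<in>img K. g K y = g K (y - (y $ nrm) *\<^sub>R axis nrm 1) \<and> g K y $ nrm = axis nrm 1))"

definition reflect :: "'n::{finite, linorder} rvec \<Rightarrow> 'n rvec" where
  "reflect y = (\<chi> i. if i = nrm then - (y $ i) else y $ i)"

(* The double of X is modelled on pairs (x, b): (x, True) lies in the first copy, (x, False) in
   the second one, and a boundary point y is represented by (y, True) only. The double of a
   chart is used for charts missing the boundary, where it has two components, and for collar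
   charts. The reflection on the second copy makes the double an oriented manifold
   containing the first copy with its given orientation. *)
definition double_chart ::
    "'a set \<Rightarrow> ('a, 'n::{finite, linorder}) chart \<Rightarrow> ('a \<times> bool, 'n) chart" where
  "double_chart Y C = ({(x, b). x \<in> fst C \<and> (x \<in> Y \<longrightarrow> b)},
     (\<lambda>(x, b). if b then snd C x else reflect (snd C x)))"

definition double ::
    "('a, 'n::{finite, linorder}) chart set \<Rightarrow> ('a \<Rightarrow> real \<Rightarrow> 'a) \<Rightarrow> real \<Rightarrow> ('a \<times> bool, 'n) chart set" where
  "double A c \<epsilon> = double_chart (bdry A) `
     ((\<lambda>C. (fst C - bdry A, snd C)) ` A \<union> collar_chart (bdry A) c \<epsilon> ` A)"

definition double_fun :: "('a \<Rightarrow> 'b) \<Rightarrow> 'a \<times> bool \<Rightarrow> 'b" where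
  "double_fun f = (\<lambda>(x, b). f x)"

(* The metric h \<union> h. The chart C of the double is double_chart Y K for the chart K below;
   on the second copy the metric is the pullback of h under the reflection. *)
definition double_metric ::
    "('a, 'n::{finite, linorder}) metric \<Rightarrow> ('a \<times> bool, 'n) metric" where
  "double_metric h = (\<lambda>C y.
     let K = ({x. (x, True) \<in> fst C}, \<lambda>x. snd C (x, True)); R = matrix reflect
     in if 0 \<le> y $ nrm then h K y else transpose R ** h K (reflect y) ** R)"

(* C^\<infinity>(X): restrictions to X of smooth functions on the double D. *)
definition extends_to :: "('a \<times> bool, 'n::finite) chart set \<Rightarrow> 'a set \<Rightarrow>
    ('a \<times> bool \<Rightarrow> 'b::real_normed_vector) \<Rightarrow> ('a \<Rightarrow> 'b) \<Rightarrow> bool" where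
  "extends_to D X F f \<longleftrightarrow> smooth_fun D F \<and> (\<forall>x\<in>X. F (x, True) = f x)"

definition Cinf :: "('a \<times> bool, 'n::finite) chart set \<Rightarrow> 'a set \<Rightarrow> ('a \<Rightarrow> 'b::real_normed_vector) set" where
  "Cinf D X = {f. \<exists>F. extends_to D X F f}"


section \<open>Complex differential forms\<close>

(* An element of the complexified exterior algebra of (R^n)* is given by its components with
   respect to dx_I = dx_{i1} \<and> ... \<and> dx_{ik}, I = {i1 < ... < ik}. *)
type_synonym 'n ext = "complex ^ ('n set)"
type_synonym ('p, 'n) form = "('p, 'n) chart \<Rightarrow> 'n rvec \<Rightarrow> complex ^ ('n set)"

(* Minor with rows I and columns J. *)
definition minor :: "'n rmat \<Rightarrow> 'n::{finite, linorder} set \<Rightarrow> 'n set \<Rightarrow> real" where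
  "minor M I J = (\<Sum>p | p permutes {..<card I}. of_int (sign p) *
     (\<Prod>a<card I. M $ (sorted_list_of_set I ! a) $ (sorted_list_of_set J ! p a)))"

(* Pullback of forms under the linear map M: dx_K pulls back to the sum over I of
   (minor M K I) dx_I. *)
definition pull :: "'n rmat \<Rightarrow> 'n::{finite, linorder} ext \<Rightarrow> 'n ext" where
  "pull M \<alpha> = (\<chi> I. \<Sum>K | card K = card I. of_real (minor M K I) * \<alpha> $ K)"

definition is_form :: "('p, 'n::{finite, linorder}) chart set \<Rightarrow> nat \<Rightarrow> ('p, 'n) form \<Rightarrow> bool" where
  "is_form A k \<omega> \<longleftrightarrow>
     (\<forall>C\<in>A. \<forall>y\<in>img C. \<forall>I. card I \<noteq> k \<longrightarrow> \<omega> C y $ I = 0) \<and>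
     (\<forall>C\<in>A. \<forall>D\<in>A. \<forall>y\<in>overlap C D. \<omega> C y = pull (jac C D y) (\<omega> D (transition C D y)))"

definition smooth_form :: "('p, 'n::{finite, linorder}) chart set \<Rightarrow> nat \<Rightarrow> ('p, 'n) form \<Rightarrow> bool" where
  "smooth_form A k \<omega> \<longleftrightarrow> is_form A k \<omega> \<and> (\<forall>C\<in>A. smooth_on (img C) (\<omega> C))"

definition ext_d :: "('p, 'n::{finite, linorder}) form \<Rightarrow> ('p, 'n) form" where
  "ext_d \<omega> = (\<lambda>C y. \<chi> J. \<Sum>j\<in>J. (- 1) ^ card {i\<in>J. i < j} *
     frechet_derivative (\<lambda>z. \<omega> C z $ (J - {j})) (at y) (axis j 1))"

definition mult_form :: "('p \<Rightarrow> complex) \<Rightarrow> ('p, 'n::finite) form \<Rightarrow> ('p, 'n) form" where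
  "mult_form f \<omega> = (\<lambda>C y. f (cinv C y) *s \<omega> C y)"


section \<open>Square integrable forms\<close>

(* Integration of densities on a compact manifold (A consists of charts with open images):
   a finite cover by chart domains is made disjoint. The result does not depend on the cover. *)
definition chart_cover :: "('p, 'n) chart set \<Rightarrow> ('p, 'n) chart list" where
  "chart_cover A = (SOME cs. set cs \<subseteq> A \<and> (\<Union>C\<in>set cs. fst C) = points A)"

definition piece :: "('p, 'n) chart list \<Rightarrow> nat \<Rightarrow> ('n rvec) set" where
  "piece cs i = snd (cs ! i) ` (fst (cs ! i) - (\<Union>j<i. fst (cs ! j)))"

definition integrable_density ::
    "('p, 'n::finite) chart set \<Rightarrow> (('p, 'n) chart \<Rightarrow> 'n rvec \<Rightarrow> complex) \<Rightarrow> bool" where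
  "integrable_density A \<rho> \<longleftrightarrow> (let cs = chart_cover A in
     \<forall>i<length cs. set_integrable lborel (piece cs i) (\<rho> (cs ! i)))"

definition integral_density ::
    "('p, 'n::finite) chart set \<Rightarrow> (('p, 'n) chart \<Rightarrow> 'n rvec \<Rightarrow> complex) \<Rightarrow> complex" where
  "integral_density A \<rho> = (let cs = chart_cover A in
     \<Sum>i<length cs. set_lebesgue_integral lborel (piece cs i) (\<rho> (cs ! i)))"

(* The density <alpha, beta>_h dvol_h, where <dx_I, dx_J>_h is the (I,J)-minor of the inverse
   matrix of h. *)
definition inner_density :: "('p, 'n::{finite, linorder}) metric \<Rightarrow> nat \<Rightarrow>
    ('p, 'n) form \<Rightarrow> ('p, 'n) form \<Rightarrow> ('p, 'n) chart \<Rightarrow> 'n rvec \<Rightarrow> complex" where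
  "inner_density h k \<alpha> \<beta> = (\<lambda>C y.
     (\<Sum>I | card I = k. \<Sum>J | card J = k.
        of_real (minor (matrix_inv (h C y)) I J) * \<alpha> C y $ I * cnj (\<beta> C y $ J)) *
     of_real (sqrt (det (h C y))))"

definition l2_inner :: "('p, 'n::{finite, linorder}) chart set \<Rightarrow> ('p, 'n) metric \<Rightarrow> nat \<Rightarrow>
    ('p, 'n) form \<Rightarrow> ('p, 'n) form \<Rightarrow> complex" where
  "l2_inner A h k \<alpha> \<beta> = integral_density A (inner_density h k \<alpha> \<beta>)"

definition l2_form :: "('p, 'n::{finite, linorder}) chart set \<Rightarrow> ('p, 'n) metric \<Rightarrow> nat \<Rightarrow>
    ('p, 'n) form \<Rightarrow> bool" where
  "l2_form A h k \<omega> \<longleftrightarrow> is_form A k \<omega> \<and>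
     (\<forall>C\<in>A. \<omega> C \<in> borel_measurable (restrict_space borel (img C))) \<and>
     integrable_density A (inner_density h k \<omega> \<omega>)"

(* theta represents the orthogonal projection of omega onto the L2-closure of the image of d on
   smooth (k-1)-forms. *)
definition is_proj_exact :: "('p, 'n::{finite, linorder}) chart set \<Rightarrow> ('p, 'n) metric \<Rightarrow> nat \<Rightarrow>
    ('p, 'n) form \<Rightarrow> ('p, 'n) form \<Rightarrow> bool" where
  "is_proj_exact A h k \<omega> \<theta> \<longleftrightarrow> l2_form A h k \<theta> \<and>
     (\<forall>e>0. \<exists>\<beta>. smooth_form A (k - 1) \<beta> \<and>
        Re (l2_inner A h k (\<theta> - ext_d \<beta>) (\<theta> - ext_d \<beta>)) < e\<^sup>2) \<and>
     (\<forall>\<beta>. smooth_form A (k - 1) \<beta> \<longrightarrow> l2_inner A h k (\<omega> - \<theta>) (ext_d \<beta>) = 0)"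

(* Operators on L2 act on representatives; the projection is determined almost everywhere,
   and depends only on the class of omega. *)
definition proj_exact :: "('p, 'n::{finite, linorder}) chart set \<Rightarrow> ('p, 'n) metric \<Rightarrow> nat \<Rightarrow>
    ('p, 'n) form \<Rightarrow> ('p, 'n) form" where
  "proj_exact A h k \<omega> = (SOME \<theta>. is_proj_exact A h k \<omega> \<theta>)"

(* F = 2P - 1 *)
definition op_F :: "('p, 'n::{finite, linorder}) chart set \<Rightarrow> ('p, 'n) metric \<Rightarrow> nat \<Rightarrow>
    ('p, 'n) form \<Rightarrow> ('p, 'n) form" where
  "op_F A h k \<omega> = (\<lambda>C y. 2 *\<^sub>R proj_exact A h k \<omega> C y - \<omega> C y)"

(* [S, f] with f acting by multiplication *)
definition commut :: "(('p, 'n::finite) form \<Rightarrow> ('p, 'n) form) \<Rightarrow> ('p \<Rightarrow> complex) \<Rightarrow>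
    ('p, 'n) form \<Rightarrow> ('p, 'n) form" where
  "commut S f \<omega> = S (mult_form f \<omega>) - mult_form f (S \<omega>)"


section \<open>Symbols and the Wodzicki residue density\<close>

definition block :: "nat \<Rightarrow> complex ^ ('n::finite set) ^ ('n set) \<Rightarrow> bool" where
  "block k M \<longleftrightarrow> (\<forall>I J. M $ I $ J \<noteq> 0 \<longrightarrow> card I = k \<and> card J = k)"

(* a is a classical symbol of order m on V with values in the endomorphisms of the k-th exterior
   power: it has the asymptotic expansion with terms as j, j = m, m-1, m-2, ...,
   where as j is homogeneous of degree j in xi. *)
definition classical_symbol :: "nat \<Rightarrow> ('n::finite rvec) set \<Rightarrow> int \<Rightarrow>
    ('n rvec \<Rightarrow> 'n rvec \<Rightarrow> complex ^ ('n set) ^ ('n set)) \<Rightarrow>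
    (int \<Rightarrow> 'n rvec \<Rightarrow> 'n rvec \<Rightarrow> complex ^ ('n set) ^ ('n set)) \<Rightarrow> bool" where
  "classical_symbol k V m a as \<longleftrightarrow>
     smooth_on (V \<times> UNIV) (\<lambda>(y, \<xi>). a y \<xi>) \<and> (\<forall>y\<in>V. \<forall>\<xi>. block k (a y \<xi>)) \<and>
     (\<forall>j. smooth_on (V \<times> (- {0})) (\<lambda>(y, \<xi>). as j y \<xi>)) \<and>
     (\<forall>j. \<forall>y\<in>V. \<forall>\<xi>. \<xi> \<noteq> 0 \<longrightarrow> block k (as j y \<xi>) \<and> (m < j \<longrightarrow> as j y \<xi> = 0) \<and>
        (\<forall>t>0. as j y (t *\<^sub>R \<xi>) = (t powi j) *\<^sub>R as j y \<xi>)) \<and>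
     (\<forall>l\<le>m. \<forall>us vs :: 'n list. \<forall>L. compact L \<and> L \<subseteq> V \<longrightarrow>
        (\<exists>B. \<forall>y\<in>L. \<forall>\<xi>. 1 \<le> norm \<xi> \<longrightarrow>
           norm (iter_deriv (map (\<lambda>i. (axis i 1, 0)) us @ map (\<lambda>i. (0, axis i 1)) vs)
                   (\<lambda>(y, \<xi>). a y \<xi> - (\<Sum>j\<in>{l<..m}. as j y \<xi>)) (y, \<xi>))
             \<le> B * (1 + norm \<xi>) powr (of_int l - real (length vs))))"

definition fourier :: "('n::finite rvec \<Rightarrow> 'n ext) \<Rightarrow> 'n rvec \<Rightarrow> 'n ext" where
  "fourier u \<xi> = (LINT y|lborel. cis (- (y \<bullet> \<xi>)) *s u y)"

definition quantize :: "('n::finite rvec \<Rightarrow> 'n rvec \<Rightarrow> complex ^ ('n set) ^ ('n set)) \<Rightarrow>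
    ('n rvec \<Rightarrow> 'n ext) \<Rightarrow> 'n rvec \<Rightarrow> 'n ext" where
  "quantize a u y = (1 / (2 * pi) ^ CARD('n)) *\<^sub>R
     (LINT \<xi>|lborel. cis (y \<bullet> \<xi>) *s (a y \<xi> *v fourier u \<xi>))"

(* smooth k-forms with compact support in V *)
definition test_form :: "nat \<Rightarrow> ('n::finite rvec) set \<Rightarrow> ('n rvec \<Rightarrow> 'n ext) \<Rightarrow> bool" where
  "test_form k V u \<longleftrightarrow> smooth_on UNIV u \<and> (\<forall>y I. card I \<noteq> k \<longrightarrow> u y $ I = 0) \<and>
     (\<exists>L. compact L \<and> L \<subseteq> V \<and> (\<forall>y. y \<notin> L \<longrightarrow> u y = 0))"

(* extension by zero of a form given in the chart D *)
definition globalize :: "('p, 'n::{finite, linorder}) chart \<Rightarrow> ('n rvec \<Rightarrow> 'n ext) \<Rightarrow> ('p, 'n) form" where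
  "globalize D u = (\<lambda>C y. if cinv C y \<in> fst D then pull (jac C D y) (u (transition C D y)) else 0)"

(* In the chart D, the operator S on k-forms is the sum of the quantization of a classical symbol
   with homogeneous components as and of an operator with a smooth kernel. *)
definition symbol_in_chart :: "nat \<Rightarrow> (('p, 'n::{finite, linorder}) form \<Rightarrow> ('p, 'n) form) \<Rightarrow>
    ('p, 'n) chart \<Rightarrow> (int \<Rightarrow> 'n rvec \<Rightarrow> 'n rvec \<Rightarrow> complex ^ ('n set) ^ ('n set)) \<Rightarrow> bool" where
  "symbol_in_chart k S D as \<longleftrightarrow> (\<exists>m a K. classical_symbol k (img D) m a as \<and>
     smooth_on (img D \<times> img D) (\<lambda>(y, z). K y z) \<and>
     (\<forall>u. test_form k (img D) u \<longrightarrow>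
        (AE y in lborel. y \<in> img D \<longrightarrow>
           S (globalize D u) D y = quantize a u y + (LINT z|lborel. K y z *v u z))))"

(* The measure on the unit sphere given by the canonical volume form
   sigma = sum_j (-1)^(j-1) xi_j dxi_1 ... (omit dxi_j) ... dxi_n. As d sigma = n dxi and sigma is
   homogeneous of degree n, the measure of E is n times the Lebesgue measure of the cone
   {t xi | 0 < t < 1, xi in E}. *)
definition sphere_measure :: "('n::finite rvec) measure" where
  "sphere_measure = scale_measure (of_nat CARD('n))
     (distr (restrict_space lborel (ball 0 1)) borel (\<lambda>\<xi>. \<xi> /\<^sub>R norm \<xi>))"

(* The residue density wres(S) is the n-form whose coefficient with respect to dx_1 ... dx_n in
   the positively oriented chart D is this number at y. The homogeneous components of the symbol
   are uniquely determined for xi \<noteq> 0. *)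
definition wres :: "nat \<Rightarrow> (('p, 'n::{finite, linorder}) form \<Rightarrow> ('p, 'n) form) \<Rightarrow>
    ('p, 'n) chart \<Rightarrow> 'n rvec \<Rightarrow> complex" where
  "wres k S D y = (THE w. \<exists>as. symbol_in_chart k S D as \<and>
     w = (LINT \<xi>|sphere_measure. trace (as (- int CARD('n)) y \<xi>)))"


section \<open>The form \<open>\<Omega>\<close>\<close>

(* The coefficient of wres([F,F1][F,F2]), common to all extensions F1, F2 of f1, f2. *)
definition Omega_coeff :: "('a, 'n::{finite, linorder}) chart set \<Rightarrow> ('a \<Rightarrow> real \<Rightarrow> 'a) \<Rightarrow> real \<Rightarrow>
    ('a, 'n) metric \<Rightarrow> ('a \<Rightarrow> complex) \<Rightarrow> ('a \<Rightarrow> complex) \<Rightarrow>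
    ('a \<times> bool, 'n) chart \<Rightarrow> 'n rvec \<Rightarrow> complex" where
  "Omega_coeff A c \<epsilon> h f1 f2 C y =
     (let D = double A c \<epsilon>; k = CARD('n) div 2; F = op_F D (double_metric h) k
      in THE w. \<forall>F1 F2. extends_to D (points A) F1 f1 \<and> extends_to D (points A) F2 f2 \<longrightarrow>
           w = wres k (commut F F1 \<circ> commut F F2) C y)"

(* The n-form Omega_{n,h}(f1,f2) on X, expressed in the charts of the double; its local expression
   is set to 0 at points outside the first copy X. *)
definition Omega :: "('a, 'n::{finite, linorder}) chart set \<Rightarrow> ('a \<Rightarrow> real \<Rightarrow> 'a) \<Rightarrow> real \<Rightarrow>
    ('a, 'n) metric \<Rightarrow> ('a \<Rightarrow> complex) \<Rightarrow> ('a \<Rightarrow> complex) \<Rightarrow> ('a \<times> bool, 'n) form" where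
  "Omega A c \<epsilon> h f1 f2 = (\<lambda>C y.
     if C \<in> double A c \<epsilon> \<and> y \<in> snd C ` {p \<in> fst C. snd p}
     then axis UNIV (Omega_coeff A c \<epsilon> h f1 f2 C y) else 0)"

end

theory Submission
  imports Defs
begin

text \<open>
  The metric of a Riemannian manifold enters the operator \<open>F = 2P - 1\<close> on middle degree forms only
  through the density \<open>\<langle>\<alpha>, \<beta>\<rangle> dvol\<close>, which decides which forms are square integrable and which
  vectors are orthogonal; the exterior derivative, whose image \<open>P\<close> projects onto, does not see the
  metric. If the metric is multiplied at a point by \<open>s > 0\<close> then the inner product of covectors
  is multiplied by \<open>1/s\<close>, that of \<open>k\<close>-forms by \<open>s\<^sup>-\<^sup>k\<close>, and the volume element by \<open>s\<^sup>n\<^sup>/\<^sup>2\<close>. The two factors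
  cancel for \<open>k = n/2\<close>. So \<open>g\<close> and \<open>exp \<eta> g\<close> have the same Hilbert space of middle degree forms
  on the double, hence the same \<open>P\<close>, the same \<open>F\<close>, the same commutators \<open>[F, f]\<close>
  and the same residue density.

  The cancellation is a pointwise statement about matrices
  (\<open>minor_matrix_inv_scaleR_mult_sqrt_det\<close>), and \<open>h \<union> h\<close> is rescaled pointwise when \<open>h\<close> is
  (\<open>double_metric_conf\<close>).
\<close>

lemma minor_scaleR: "minor (r *\<^sub>R M) I J = r ^ card I * minor M I J"
  by (simp add: minor_def prod.distrib sum_distrib_left mult_ac)

lemma det_scaleR: "det (r *\<^sub>R M) = r ^ CARD('n) * det (M :: real ^ 'n ^ 'n::finite)"
  by (simp add: det_def prod.distrib sum_distrib_left mult_ac)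

lemma matrix_inv_scaleR:
  fixes M :: "real ^ 'n ^ 'n::finite"
  assumes "r \<noteq> 0" and "invertible M"
  shows "matrix_inv (r *\<^sub>R M) = inverse r *\<^sub>R matrix_inv M"
proof -
  have M: "M ** matrix_inv M = mat 1 \<and> matrix_inv M ** M = mat 1"
    using \<open>invertible M\<close> unfolding invertible_def matrix_inv_def by (rule someI_ex)
  show ?thesis
    unfolding matrix_inv_def[of "r *\<^sub>R M"]
  proof (rule some_equality)
    show "r *\<^sub>R M ** (inverse r *\<^sub>R matrix_inv M) = mat 1 \<and>
        inverse r *\<^sub>R matrix_inv M ** (r *\<^sub>R M) = mat 1"
      using M \<open>r \<noteq> 0\<close> by (simp add: scalar_matrix_assoc[symmetric] matrix_scalar_ac)
  next
    fix N assume "r *\<^sub>R M ** N = mat 1 \<and> N ** (r *\<^sub>R M) = mat 1"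
    then have "r *\<^sub>R (M ** N) = mat 1"
      by (simp add: scalar_matrix_assoc)
    then have "M ** N = inverse r *\<^sub>R mat 1"
      using \<open>r \<noteq> 0\<close> by (metis inverse_eq_divide scaleR_one scaleR_scaleR left_inverse)
    then have "matrix_inv M ** (M ** N) = inverse r *\<^sub>R matrix_inv M"
      by (simp add: matrix_scalar_ac)
    then show "N = inverse r *\<^sub>R matrix_inv M"
      using M by (simp add: matrix_mul_assoc)
  qed
qed

text \<open>
  Since \<open>n = 2k\<close> for \<open>k = card I\<close>, the factor \<open>r\<^sup>-\<^sup>k\<close> from the minor of the inverse cancels
  \<open>sqrt (r\<^sup>n) = r\<^sup>k\<close> from the volume element.
  The inverse of a singular \<open>M\<close> carries no information, but then both sides vanish with the
  determinant. This makes densities equal as functions on all arguments, also off the images of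
  the charts, where the coefficients of a metric can be anything.
\<close>

lemma minor_matrix_inv_scaleR_mult_sqrt_det:
  fixes M :: "'n::{finite, linorder} rmat"
  assumes "0 < r" and "CARD('n) = 2 * card I"
  shows "minor (matrix_inv (r *\<^sub>R M)) I J * sqrt (det (r *\<^sub>R M)) =
    minor (matrix_inv M) I J * sqrt (det M)"
proof (cases "invertible M")
  case True
  have "sqrt (r ^ CARD('n)) = r ^ card I"
    using assms by (simp add: power_even_abs real_sqrt_power power_mult)
  moreover have "inverse r ^ card I * r ^ card I = 1"
    using \<open>0 < r\<close> by (simp add: power_mult_distrib[symmetric])
  ultimately show ?thesis
    using True \<open>0 < r\<close>
    by (simp add: matrix_inv_scaleR minor_scaleR det_scaleR real_sqrt_mult)
next
  case False
  then have "det M = 0"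
    by (simp add: invertible_det_nz)
  then show ?thesis
    by (simp add: det_scaleR)
qed

lemma inner_density_middle_degree_scaleR:
  fixes h h' :: "('p, 'n::{finite, linorder}) metric"
  assumes "\<And>C y. \<exists>r>0. h' C y = r *\<^sub>R h C y" and "CARD('n) = 2 * k"
  shows "inner_density h' k = inner_density h k"
proof (intro ext)
  fix \<alpha> \<beta> :: "('p, 'n) form" and C :: "('p, 'n) chart" and y :: "'n rvec"
  obtain r where "0 < r" and r: "h' C y = r *\<^sub>R h C y"
    using assms(1) by blast
  have pull_out: "inner_density g k \<alpha> \<beta> C y =
      (\<Sum>I | card I = k. \<Sum>J | card J = k.
        of_real (minor (matrix_inv (g C y)) I J * sqrt (det (g C y))) *
        (\<alpha> C y $ I * cnj (\<beta> C y $ J)))" for g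
    unfolding inner_density_def by (simp add: sum_distrib_left sum_distrib_right mult_ac)
  have "minor (matrix_inv (r *\<^sub>R h C y)) I J * sqrt (det (r *\<^sub>R h C y)) =
      minor (matrix_inv (h C y)) I J * sqrt (det (h C y))" if "card I = k" for I J
    using \<open>0 < r\<close> assms(2) that by (intro minor_matrix_inv_scaleR_mult_sqrt_det) simp_all
  then show "inner_density h' k \<alpha> \<beta> C y = inner_density h k \<alpha> \<beta> C y"
    unfolding pull_out r by (intro sum.cong refl) (simp del: of_real_mult)
qed

lemma double_metric_conf: "\<exists>r>0. double_metric (conf \<eta> h) C y = r *\<^sub>R double_metric h C y"
proof -
  define K where "K = ({x. (x, True) \<in> fst C}, \<lambda>x. snd C (x, True))"
  \<comment> \<open>On the second copy the factor is the one at the mirror image of the point: it is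
    the exponential of \<open>\<eta> \<union> \<eta>\<close>.\<close>
  define r where "r = exp (\<eta> (cinv K (if 0 \<le> y $ nrm then y else reflect y)))"
  have "double_metric (conf \<eta> h) C y = r *\<^sub>R double_metric h C y"
    by (simp add: double_metric_def conf_def Let_def K_def[symmetric] r_def
        scalar_matrix_assoc[symmetric] matrix_scalar_ac)
  moreover have "0 < r"
    by (simp add: r_def)
  ultimately show ?thesis
    by blast
qed

text \<open>
  The projection is chosen among its almost everywhere equal representatives by a condition that
  involves the metric only through the density; equal densities therefore give literally the same
  operator and not just one that agrees almost everywhere.
\<close>

lemma op_F_cong_inner_density:
  assumes "inner_density h k = inner_density h' k"
  shows "op_F A h k = op_F A h' k"
proof -
  have "is_proj_exact A h k = is_proj_exact A h' k"
    unfolding is_proj_exact_def l2_form_def l2_inner_def assms ..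
  then show ?thesis
    unfolding op_F_def proj_exact_def by simp
qed

theorem proposition4p4:
  fixes T :: "'a topology"
    and A :: "('a, 'n::{finite, linorder}) chart set"
    and g :: "('a, 'n) metric"
    and c :: "'a \<Rightarrow> real \<Rightarrow> 'a" and \<epsilon> :: real
    and \<eta> :: "'a \<Rightarrow> real"
    and f1 f2 :: "'a \<Rightarrow> complex"
  assumes "even CARD('n)"
    and "compact_oriented_manifold T A"
    and "riemannian_metric A g"
    and "product_collar A g c \<epsilon>"
    and "\<eta> \<in> Cinf (double A c \<epsilon>) (topspace T)"
    and "smooth_fun (double A c \<epsilon>) (double_fun \<eta>)"
    and "f1 \<in> Cinf (double A c \<epsilon>) (topspace T)"
    and "f2 \<in> Cinf (double A c \<epsilon>) (topspace T)"
  shows "Omega A c \<epsilon> g f1 f2 = Omega A c \<epsilon> (conf \<eta> g) f1 f2"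
proof -
  have "CARD('n) = 2 * (CARD('n) div 2)"
    using \<open>even CARD('n)\<close> by simp
  then have "inner_density (double_metric (conf \<eta> g)) (CARD('n) div 2) =
      inner_density (double_metric g) (CARD('n) div 2)"
    by (intro inner_density_middle_degree_scaleR double_metric_conf)
  then have "op_F D (double_metric g) (CARD('n) div 2) =
      op_F D (double_metric (conf \<eta> g)) (CARD('n) div 2)" for D
    by (intro op_F_cong_inner_density) simp
  then show ?thesis
    unfolding Omega_def Omega_coeff_def by (simp only: Let_def)
qed

end
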